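(* Let $\mathcal A=\{0,1\}$ and let $$\widehat{\mathrm{ATE}}_{\mathrm{IPW}}=\frac1n\sum_{i=1}^n\rho_{\mathrm{ATE}}(a_i,x_i)\,y_i,\qquad \widehat{\mathrm{ATE}}_{\mathrm{MR}}=\frac1n\sum_{i=1}^n w_{\mathrm{ATE}}(y_i)\,y_i,$$ where $$\rho_{\mathrm{ATE}}(a,x)=\frac{\mathbb 1(a=1)-\mathbb 1(a=0)}{\pi^b(a\mid x)},\qquad w_{\mathrm{ATE}}(y)=\frac{p_{\pi^{(1)}}(y)-p_{\pi^{(0)}}(y)}{p_{\pi^b}(y)} .$$ When the weights $\rho_{\mathrm{ATE}}(a,x)$ and $w_{\mathrm{ATE}}(y)$ are known exactly, $\mathrm{Var}[\widehat{\mathrm{ATE}}_{\mathrm{MR}}]\le\mathrm{Var}[\widehat{\mathrm{ATE}}_{\mathrm{IPW}}]$. Specifically, $$\mathrm{Var}[\widehat{\mathrm{ATE}}_{\mathrm{IPW}}]-\mathrm{Var}[\widehat{\mathrm{ATE}}_{\mathrm{MR}}]=\frac1n\,\mathbb E\big[\mathrm{Var}[\rho_{\mathrm{ATE}}(A,X)\mid Y]\;Y^2\big]\ge 0 .$$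
   Context: $X\in\mathcal X$ is a covariate vector, $A\in\mathcal A=\{0,1\}$ a treatment, $Y\in\mathcal Y\subseteq\mathbb R$ a scalar outcome. For a policy $\pi(a\mid x)$ the joint density of $(X,A,Y)$ is $p_\pi(x,a,y)=p(y\mid x,a)\,\pi(a\mid x)\,p(x)$ (with respect to fixed reference measures), with $Y$-marginal $p_\pi(y)$. $\pi^b$ is the behaviour (treatment assignment) policy and, for $a\in\{0,1\}$, $\pi^{(a)}(a'\mid x)=\mathbb 1(a'=a)$ is the deterministic policy always choosing $a$. The data $(x_i,a_i,y_i)_{i=1}^n$ are i.i.d. from $p_{\pi^b}$, and $\mathbb E,\mathrm{Var}$ (for $(X,A,Y)$ and for the estimators) are under $\pi^b$. Standing assumption (support) for the target policies $\pi^{(0)},\pi^{(1)}$: $\pi^b(a\mid x)>0$ for all $x\in\mathcal X$, $a\in\{0,1\}$. All expectations and variances appearing are implicitly assumed to exist and be finite. *)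

theory Defs
  imports "HOL-Probability.Probability"
begin

text \<open>
  The reference measures are \<open>mX\<close> on the covariates, counting measure on the treatments
  \<open>{0, 1}\<close> (so that a policy is a probability mass function), and \<open>mY\<close> on the outcomes.
  The covariate space is \<open>space mX\<close> and the outcome space is \<open>space mY\<close>, a subset of the reals.
  Densities and policies are written in the order of the conditional notation:
  \<open>pY y x a\<close> is p(y | x, a) and \<open>\<pi> a x\<close> is \<open>\<pi>\<close>(a | x).
\<close>

definition sample_space :: "'x measure \<Rightarrow> real measure \<Rightarrow> ('x \<times> nat \<times> real) measure" where
  "sample_space mX mY = mX \<Otimes>\<^sub>M count_space {0, 1} \<Otimes>\<^sub>M mY"

definition policy :: "'x measure \<Rightarrow> (nat \<Rightarrow> 'x \<Rightarrow> real) \<Rightarrow> bool" where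
  "policy mX \<pi> \<longleftrightarrow>
     (\<forall>a\<in>{0, 1}. \<pi> a \<in> borel_measurable mX) \<and>
     (\<forall>a\<in>{0, 1}. \<forall>x\<in>space mX. 0 \<le> \<pi> a x) \<and>
     (\<forall>x\<in>space mX. (\<Sum>a\<in>{0, 1}. \<pi> a x) = 1)"

definition det_policy :: "nat \<Rightarrow> nat \<Rightarrow> 'x \<Rightarrow> real" where
  "det_policy a = (\<lambda>a' x. of_bool (a' = a))"

locale treatment_model =
  fixes mX :: "'x measure" and mY :: "real measure"
    and pX :: "'x \<Rightarrow> real" and pY :: "real \<Rightarrow> 'x \<Rightarrow> nat \<Rightarrow> real"
    and \<pi>b :: "nat \<Rightarrow> 'x \<Rightarrow> real"
  assumes sigma_finite_mX: "sigma_finite_measure mX"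
    and sigma_finite_mY: "sigma_finite_measure mY"
    and sets_mY: "sets mY = sets (restrict_space borel (space mY))"
    and pX_measurable: "pX \<in> borel_measurable mX"
    and pX_nonneg: "\<And>x. x \<in> space mX \<Longrightarrow> 0 \<le> pX x"
    and pX_normalized: "(\<integral>\<^sup>+ x. ennreal (pX x) \<partial>mX) = 1"
    and pY_measurable:
      "\<And>a. a \<in> {0, 1} \<Longrightarrow> (\<lambda>(x, y). pY y x a) \<in> borel_measurable (mX \<Otimes>\<^sub>M mY)"
    and pY_nonneg:
      "\<And>x a y. x \<in> space mX \<Longrightarrow> a \<in> {0, 1} \<Longrightarrow> y \<in> space mY \<Longrightarrow> 0 \<le> pY y x a"
    and pY_normalized:
      "\<And>x a. x \<in> space mX \<Longrightarrow> a \<in> {0, 1} \<Longrightarrow> (\<integral>\<^sup>+ y. ennreal (pY y x a) \<partial>mY) = 1"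
    and policy_\<pi>b: "policy mX \<pi>b"
    and support: "\<And>x a. x \<in> space mX \<Longrightarrow> a \<in> {0, 1} \<Longrightarrow> 0 < \<pi>b a x"

definition joint_density ::
  "('x \<Rightarrow> real) \<Rightarrow> (real \<Rightarrow> 'x \<Rightarrow> nat \<Rightarrow> real) \<Rightarrow> (nat \<Rightarrow> 'x \<Rightarrow> real) \<Rightarrow> 'x \<times> nat \<times> real \<Rightarrow> real" where
  "joint_density pX pY \<pi> = (\<lambda>(x, a, y). pY y x a * \<pi> a x * pX x)"

definition joint_law ::
  "'x measure \<Rightarrow> real measure \<Rightarrow> ('x \<Rightarrow> real) \<Rightarrow> (real \<Rightarrow> 'x \<Rightarrow> nat \<Rightarrow> real) \<Rightarrow> (nat \<Rightarrow> 'x \<Rightarrow> real)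
     \<Rightarrow> ('x \<times> nat \<times> real) measure" where
  "joint_law mX mY pX pY \<pi> =
     density (sample_space mX mY) (\<lambda>z. ennreal (joint_density pX pY \<pi> z))"

text \<open>
  The integral below is finite for \<open>mY\<close>-almost every \<open>y\<close>; on the exceptional null set the
  Bochner integral takes the value 0.
\<close>

definition outcome_density ::
  "'x measure \<Rightarrow> ('x \<Rightarrow> real) \<Rightarrow> (real \<Rightarrow> 'x \<Rightarrow> nat \<Rightarrow> real) \<Rightarrow> (nat \<Rightarrow> 'x \<Rightarrow> real) \<Rightarrow> real \<Rightarrow> real" where
  "outcome_density mX pX pY \<pi> y = (LINT x|mX. (\<Sum>a\<in>{0, 1}. joint_density pX pY \<pi> (x, a, y)))"

definition rho_ATE :: "(nat \<Rightarrow> 'x \<Rightarrow> real) \<Rightarrow> nat \<Rightarrow> 'x \<Rightarrow> real" where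
  "rho_ATE \<pi>b a x = (of_bool (a = 1) - of_bool (a = 0)) / \<pi>b a x"

text \<open>
  Under the law of the data, the outcomes with \<open>outcome_density mX pX pY \<pi>b y = 0\<close>, where the
  quotient is 0 by convention, have probability 0.
\<close>

definition w_ATE ::
  "'x measure \<Rightarrow> ('x \<Rightarrow> real) \<Rightarrow> (real \<Rightarrow> 'x \<Rightarrow> nat \<Rightarrow> real) \<Rightarrow> (nat \<Rightarrow> 'x \<Rightarrow> real) \<Rightarrow> real \<Rightarrow> real" where
  "w_ATE mX pX pY \<pi>b y =
     (outcome_density mX pX pY (det_policy 1) y - outcome_density mX pX pY (det_policy 0) y)
       / outcome_density mX pX pY \<pi>b y"

text \<open>In both estimators \<open>D i\<close> is the observation \<open>(x\<^sub>i, a\<^sub>i, y\<^sub>i)\<close>, a random variable.\<close>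

definition ATE_IPW ::
  "(nat \<Rightarrow> 'x \<Rightarrow> real) \<Rightarrow> nat \<Rightarrow> (nat \<Rightarrow> 'w \<Rightarrow> 'x \<times> nat \<times> real) \<Rightarrow> 'w \<Rightarrow> real" where
  "ATE_IPW \<pi>b n D \<omega> = 1 / real n * (\<Sum>i=1..n. case D i \<omega> of (x, a, y) \<Rightarrow> rho_ATE \<pi>b a x * y)"

definition ATE_MR ::
  "'x measure \<Rightarrow> ('x \<Rightarrow> real) \<Rightarrow> (real \<Rightarrow> 'x \<Rightarrow> nat \<Rightarrow> real) \<Rightarrow> (nat \<Rightarrow> 'x \<Rightarrow> real)
     \<Rightarrow> nat \<Rightarrow> (nat \<Rightarrow> 'w \<Rightarrow> 'x \<times> nat \<times> real) \<Rightarrow> 'w \<Rightarrow> real" where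
  "ATE_MR mX pX pY \<pi>b n D \<omega> =
     1 / real n * (\<Sum>i=1..n. case D i \<omega> of (x, a, y) \<Rightarrow> w_ATE mX pX pY \<pi>b y * y)"

text \<open>
  The conditional variance of \<open>f\<close> given the real random variable \<open>Y\<close>. The outer
  conditional expectation is applied to a nonnegative function, so its value is the conditional expectation wherever
  that is finite, even if the squared deviation is not integrable over the whole space.
\<close>

definition cond_variance :: "'s measure \<Rightarrow> ('s \<Rightarrow> real) \<Rightarrow> ('s \<Rightarrow> real) \<Rightarrow> 's \<Rightarrow> real" where
  "cond_variance P Y f =
     (let F = vimage_algebra (space P) Y borel
      in real_cond_exp P F (\<lambda>\<omega>. (f \<omega> - real_cond_exp P F f \<omega>)\<^sup>2))"

end

(* Write rho = rho_ATE(A, X). The ratio pi(A | X) / pi^b(A | X) changes the law under pi^b into the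
   law under pi, so testing it against functions of Y shows that its conditional expectation given Y
   is the ratio of the outcome densities; hence E[rho | Y] = w_ATE(Y). The two summands rho Y and
   E[rho | Y] Y have the same mean, and by the Pythagorean identity for conditional expectation their
   second moments differ by E[Var[rho | Y] Y^2]. Independence divides this by n. *)

theory Submission
  imports Defs
begin

text \<open>The only moment hypothesis is square integrability of the whole IPW estimator.
  Independence brings it down to a single summand, so \<open>rho Y\<close> has a second moment under
  the data law, while \<open>rho\<close> alone may have none; the Pythagorean identity is therefore
  set up with the weight \<open>Y^2\<close> inside from the start. That \<open>rho\<close> is
  integrable, as conditioning requires, comes from the model: its numerator is the difference of the
  two deterministic policies, so \<open>rho\<close> is a difference of two ratios that are
  nonnegative and have mean 1. Treating these ratios separately also keeps the change of law within
  nonnegative integrals, where Tonelli asks for no integrability.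

  Two degenerate cases stand between the outcome ratio and the conditional expectation. The outcome
  density may be infinite, where the Bochner integral takes the value 0: this happens on an
  \<open>mY\<close>-null set. The density under \<open>\<pi>b\<close> may vanish, where the quotient
  is 0: positivity of \<open>\<pi>b\<close> makes the target densities vanish at the same
  outcomes.\<close>

section \<open>Second moments and variances of sums of independent variables\<close>

(* By Fubini, (X + y)^2 is integrable for almost every value y of Y. *)
lemma (in prob_space) integrable_square_indep_summand:
  fixes X Y :: "'a \<Rightarrow> real"
  assumes indep: "indep_var borel X borel Y"
    and sq: "integrable M (\<lambda>\<omega>. (X \<omega> + Y \<omega>)\<^sup>2)"
  shows "integrable M (\<lambda>\<omega>. (X \<omega>)\<^sup>2)"
proof -
  have [measurable]: "X \<in> borel_measurable M" "Y \<in> borel_measurable M"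
    using indep by (auto dest: indep_var_rv1 indep_var_rv2)
  interpret X: prob_space "distr M borel X" by (rule prob_space_distr) simp
  interpret Y: prob_space "distr M borel Y" by (rule prob_space_distr) simp
  interpret XY: pair_sigma_finite "distr M borel X" "distr M borel Y" ..
  have "distr M borel X \<Otimes>\<^sub>M distr M borel Y = distr M (borel \<Otimes>\<^sub>M borel) (\<lambda>\<omega>. (X \<omega>, Y \<omega>))"
    using indep by (simp add: indep_var_distribution_eq)
  then have "integrable (distr M borel X \<Otimes>\<^sub>M distr M borel Y) (\<lambda>(x, y). (x + y)\<^sup>2)"
    using sq by (simp add: integrable_distr_eq split_beta')
  then have "AE y in distr M borel Y. integrable (distr M borel X) (\<lambda>x. (x + y)\<^sup>2)"
    by (rule XY.AE_integrable_snd)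
  \<comment> \<open>What holds almost surely under a probability measure holds somewhere, and a
    single such \<open>y\<close> is enough.\<close>
  moreover have "\<not> (AE y in distr M borel Y. False)"
    by (simp add: AE_False Y.emeasure_space_1)
  ultimately obtain y where y: "integrable (distr M borel X) (\<lambda>x. (x + y)\<^sup>2)"
    by (metis (mono_tags, lifting) eventually_mono)
  have "integrable (distr M borel X) (\<lambda>x. x\<^sup>2)"
  proof (rule Bochner_Integration.integrable_bound)
    show "integrable (distr M borel X) (\<lambda>x. 2 * (x + y)\<^sup>2 + 2 * y\<^sup>2)"
      using y by simp
    \<comment> \<open>The difference of the two sides is \<open>(x + 2 * y)^2\<close>.\<close>
    have "x\<^sup>2 \<le> 2 * (x + y)\<^sup>2 + 2 * y\<^sup>2" for x
      using zero_le_power2[of "x + 2 * y"] by (simp add: power2_eq_square algebra_simps)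
    then show "AE x in distr M borel X. norm (x\<^sup>2) \<le> norm (2 * (x + y)\<^sup>2 + 2 * y\<^sup>2)"
      by simp
  qed simp
  then show ?thesis
    by (simp add: integrable_distr_eq)
qed

text \<open>The sum over the other indices is independent of \<open>X i\<close> and takes the role
  of \<open>Y\<close> in \<open>integrable_square_indep_summand\<close>. Passing from the sum to a
  summand rests on independence: dependent summands could cancel.\<close>

lemma (in prob_space) integrable_square_indep_vars:
  fixes X :: "'i \<Rightarrow> 'a \<Rightarrow> real"
  assumes "finite I" "indep_vars (\<lambda>_. borel) X I" "i \<in> I"
    and "integrable M (\<lambda>\<omega>. (\<Sum>i\<in>I. X i \<omega>)\<^sup>2)"
  shows "integrable M (\<lambda>\<omega>. (X i \<omega>)\<^sup>2)"
proof (rule integrable_square_indep_summand)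
  show "indep_var borel (X i) borel (\<lambda>\<omega>. \<Sum>j\<in>I - {i}. X j \<omega>)"
    using assms by (intro indep_vars_sum) (auto simp: insert_absorb)
  show "integrable M (\<lambda>\<omega>. (X i \<omega> + (\<Sum>j\<in>I - {i}. X j \<omega>))\<^sup>2)"
    using assms(4) unfolding sum.remove[OF assms(1,3)] .
qed


text \<open>The product is dominated through \<open>2 |f g| \<le> f^2 + g^2\<close>. The use is the
  cross term of the Pythagorean identity, where both factors already carry \<open>Y\<close>.\<close>

lemma integrable_mult_of_squares:
  fixes f g :: "'a \<Rightarrow> real"
  assumes [measurable]: "f \<in> borel_measurable M" "g \<in> borel_measurable M"
    and "integrable M (\<lambda>x. (f x)\<^sup>2)" "integrable M (\<lambda>x. (g x)\<^sup>2)"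
  shows "integrable M (\<lambda>x. f x * g x)"
proof (rule Bochner_Integration.integrable_bound)
  show "integrable M (\<lambda>x. (f x)\<^sup>2 + (g x)\<^sup>2)"
    using assms by simp
  have "2 * \<bar>f x * g x\<bar> \<le> (f x)\<^sup>2 + (g x)\<^sup>2" for x
    using sum_squares_bound[of "\<bar>f x\<bar>" "\<bar>g x\<bar>"] by (simp add: abs_mult)
  then have "\<bar>f x * g x\<bar> \<le> (f x)\<^sup>2 + (g x)\<^sup>2" for x
    using abs_ge_zero[of "f x * g x"] by (smt (verit))
  then show "AE x in M. norm (f x * g x) \<le> norm ((f x)\<^sup>2 + (g x)\<^sup>2)"
    by simp
qed simp

text \<open>Square integrability of the sum is carried through the induction together with the
  variance, since the step expands the variance of the partial sum into moments.\<close>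

lemma (in prob_space) variance_indep_sum:
  fixes X :: "'i \<Rightarrow> 'a \<Rightarrow> real"
  assumes "finite I" "indep_vars (\<lambda>_. borel) X I"
    and "\<And>i. i \<in> I \<Longrightarrow> integrable M (\<lambda>\<omega>. (X i \<omega>)\<^sup>2)"
  shows "integrable M (\<lambda>\<omega>. (\<Sum>i\<in>I. X i \<omega>)\<^sup>2) \<and>
    variance (\<lambda>\<omega>. \<Sum>i\<in>I. X i \<omega>) = (\<Sum>i\<in>I. variance (X i))"
  using assms
proof (induction I)
  case (insert i I)
  let ?S = "\<lambda>\<omega>. \<Sum>j\<in>I. X j \<omega>"
  have meas [measurable]: "random_variable borel (X j)" if "j \<in> insert i I" for j
    using insert.prems(1) that by (auto simp: indep_vars_def)
  have [measurable]: "random_variable borel (X i)" "random_variable borel ?S"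
    using meas by (auto intro!: borel_measurable_sum)
  have "indep_vars (\<lambda>_. borel) X I"
    using insert.prems(1) by (rule indep_vars_subset) auto
  then have IH: "integrable M (\<lambda>\<omega>. (?S \<omega>)\<^sup>2)" "variance ?S = (\<Sum>i\<in>I. variance (X i))"
    using insert.IH insert.prems(2) by auto
  have sqX: "integrable M (\<lambda>\<omega>. (X i \<omega>)\<^sup>2)"
    using insert.prems(2) by simp
  have intX: "integrable M (X i)" and intS: "integrable M ?S"
    using IH(1) sqX by (auto intro!: square_integrable_imp_integrable)
  have indep: "indep_var borel (X i) borel ?S"
    using insert by (intro indep_vars_sum) auto
  have intXS: "integrable M (\<lambda>\<omega>. X i \<omega> * ?S \<omega>)"
    and XS: "expectation (\<lambda>\<omega>. X i \<omega> * ?S \<omega>) = expectation (X i) * expectation ?S"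
    using indep_var_integrable[OF indep intX intS] indep_var_lebesgue_integral[OF indep intX intS] by auto
  have sq: "(X i \<omega> + ?S \<omega>)\<^sup>2 = (X i \<omega>)\<^sup>2 + (?S \<omega>)\<^sup>2 + 2 * (X i \<omega> * ?S \<omega>)" for \<omega>
    by (simp add: power2_sum)
  have int: "integrable M (\<lambda>\<omega>. (X i \<omega> + ?S \<omega>)\<^sup>2)"
    unfolding sq using sqX IH(1) intXS by simp
  have "variance (\<lambda>\<omega>. X i \<omega> + ?S \<omega>) =
      expectation (\<lambda>\<omega>. (X i \<omega>)\<^sup>2) + expectation (\<lambda>\<omega>. (?S \<omega>)\<^sup>2) + 2 * (expectation (X i) * expectation ?S)
        - (expectation (X i) + expectation ?S)\<^sup>2"
    using sqX IH(1) intXS intX intS int by (subst variance_eq) (simp_all add: sq XS)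
  also have "\<dots> = variance (X i) + variance ?S"
    using sqX IH(1) intX intS by (simp add: variance_eq power2_sum)
  finally show ?case
    using int IH(2) insert.hyps by simp
qed simp

lemma (in prob_space) variance_cmult:
  "variance (\<lambda>\<omega>. c * X \<omega>) = c\<^sup>2 * variance X"
  for c :: real
  by (simp add: right_diff_distrib[symmetric] power_mult_distrib)

text \<open>Moves a variance on the data space to moments under the law \<open>P\<close> of one
  observation; the factor \<open>1 / n\<close> is \<open>n * (1 / n)^2\<close>. Both estimators are
  instances.\<close>

lemma (in prob_space) variance_sample_mean:
  fixes f :: "'b \<Rightarrow> real"
  assumes "1 \<le> n" "indep_vars (\<lambda>_. N) D {1..n}"
    and distr: "\<And>i. i \<in> {1..n} \<Longrightarrow> distr M N (D i) = P"
    and f: "f \<in> borel_measurable N" "integrable P (\<lambda>z. (f z)\<^sup>2)"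
  shows "variance (\<lambda>\<omega>. 1 / real n * (\<Sum>i=1..n. f (D i \<omega>)))
    = 1 / real n * ((LINT z|P. (f z)\<^sup>2) - (LINT z|P. f z)\<^sup>2)"
proof -
  have indep: "indep_vars (\<lambda>_. borel) (\<lambda>i \<omega>. f (D i \<omega>)) {1..n}"
    using assms(2) f(1) by (rule indep_vars_compose2)
  have D [measurable]: "D i \<in> measurable M N" if "i \<in> {1..n}" for i
    using assms(2) that by (auto simp: indep_vars_def)
  note f(1) [measurable]
  have sq: "integrable M (\<lambda>\<omega>. (f (D i \<omega>))\<^sup>2)" if "i \<in> {1..n}" for i
    using f(2) D[OF that] distr[OF that, symmetric] by (simp add: integrable_distr_eq)
  have "variance (\<lambda>\<omega>. f (D i \<omega>)) = (LINT z|P. (f z)\<^sup>2) - (LINT z|P. f z)\<^sup>2" if "i \<in> {1..n}" for i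
    using D[OF that] sq[OF that] distr[OF that, symmetric]
    by (subst variance_eq) (auto simp: integral_distr intro!: square_integrable_imp_integrable)
  then have "(\<Sum>i=1..n. variance (\<lambda>\<omega>. f (D i \<omega>)))
      = real n * ((LINT z|P. (f z)\<^sup>2) - (LINT z|P. f z)\<^sup>2)"
    by simp
  with variance_indep_sum[OF _ indep sq] have var: "variance (\<lambda>\<omega>. \<Sum>i=1..n. f (D i \<omega>))
      = real n * ((LINT z|P. (f z)\<^sup>2) - (LINT z|P. f z)\<^sup>2)"
    by auto
  show ?thesis
    unfolding variance_cmult var using \<open>1 \<le> n\<close> by (simp add: power2_eq_square)
qed

section \<open>The Pythagorean identity weighted by the square of the conditioning variable\<close>

text \<open>Orthogonality of \<open>f - E[f | Y]\<close> to functions of \<open>Y\<close>, with the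
  weight kept inside every integral because only \<open>f * Y\<close> is known to be square
  integrable. \<open>W\<close> is an arbitrary measurable version of \<open>E[f | Y]\<close>, so
  that an explicit formula can be inserted for it.\<close>

lemma (in prob_space) cond_variance_weighted:
  fixes Y f :: "'a \<Rightarrow> real"
  assumes [measurable]: "Y \<in> borel_measurable M"
    and f: "integrable M f" "integrable M (\<lambda>\<omega>. (f \<omega> * Y \<omega>)\<^sup>2)"
    and W: "W \<in> borel_measurable M"
      "AE \<omega> in M. real_cond_exp M (vimage_algebra (space M) Y borel) f \<omega> = W \<omega>"
  shows "integrable M (\<lambda>\<omega>. (W \<omega> * Y \<omega>)\<^sup>2)"
    and "expectation (\<lambda>\<omega>. W \<omega> * Y \<omega>) = expectation (\<lambda>\<omega>. f \<omega> * Y \<omega>)"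
    and "expectation (\<lambda>\<omega>. cond_variance M Y f \<omega> * (Y \<omega>)\<^sup>2)
      = expectation (\<lambda>\<omega>. (f \<omega> * Y \<omega>)\<^sup>2) - expectation (\<lambda>\<omega>. (W \<omega> * Y \<omega>)\<^sup>2)"
    and "0 \<le> expectation (\<lambda>\<omega>. cond_variance M Y f \<omega> * (Y \<omega>)\<^sup>2)"
proof -
  define F where "F = vimage_algebra (space M) Y borel"
  have subalg: "subalgebra M F"
    unfolding F_def subalgebra_def by (auto simp: sets_vimage_algebra intro!: sets.sigma_sets_subset)
  interpret finite_measure_subalgebra M F
    by unfold_locales (rule subalg)
  define E where "E = real_cond_exp M F f"
  have YF [measurable]: "Y \<in> borel_measurable F"
    unfolding F_def by (rule measurable_vimage_algebra1) auto
  have EF [measurable]: "E \<in> borel_measurable F" and [measurable]: "E \<in> borel_measurable M"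
    unfolding E_def by auto
  have [measurable]: "f \<in> borel_measurable M" "W \<in> borel_measurable M"
    using f W by auto
  have EW: "AE \<omega> in M. E \<omega> = W \<omega>"
    using W(2) by (simp add: E_def F_def)
  have fY: "integrable M (\<lambda>\<omega>. f \<omega> * Y \<omega>)"
    by (rule square_integrable_imp_integrable[OF _ f(2)]) simp
  \<comment> \<open>\<open>Y\<close> is measurable for \<open>F\<close> and can be pulled out; thus
    \<open>E * Y\<close> is the conditional expectation of the square integrable function
    \<open>f * Y\<close>.\<close>
  have "AE \<omega> in M. real_cond_exp M F (\<lambda>\<omega>. Y \<omega> * f \<omega>) \<omega> = Y \<omega> * E \<omega>"
    unfolding E_def using fY by (intro real_cond_exp_mult) (auto simp: mult.commute)
  \<comment> \<open>Conditional Jensen inequality for the square.\<close>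
  moreover have "integrable M (\<lambda>\<omega>. (real_cond_exp M F (\<lambda>\<omega>. Y \<omega> * f \<omega>) \<omega>)\<^sup>2)"
    by (rule integrable_convex_cond_exp[where I = UNIV])
      (use fY f(2) convex_power2 in \<open>auto simp: mult.commute\<close>)
  ultimately have EY: "integrable M (\<lambda>\<omega>. (E \<omega> * Y \<omega>)\<^sup>2)"
    by (subst integrable_cong_AE[where g = "\<lambda>\<omega>. (real_cond_exp M F (\<lambda>\<omega>. Y \<omega> * f \<omega>) \<omega>)\<^sup>2"])
      (auto simp: mult.commute)
  have "integrable M (\<lambda>\<omega>. (E \<omega> * Y \<omega>)\<^sup>2) \<longleftrightarrow> integrable M (\<lambda>\<omega>. (W \<omega> * Y \<omega>)\<^sup>2)"
    using EW by (intro integrable_cong_AE) auto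
  with EY show "integrable M (\<lambda>\<omega>. (W \<omega> * Y \<omega>)\<^sup>2)" by simp
  have "expectation (\<lambda>\<omega>. W \<omega> * Y \<omega>) = expectation (\<lambda>\<omega>. Y \<omega> * E \<omega>)"
    using EW by (intro integral_cong_AE) auto
  also have "\<dots> = expectation (\<lambda>\<omega>. Y \<omega> * f \<omega>)"
    unfolding E_def using fY by (intro real_cond_exp_intg(2)) (auto simp: mult.commute)
  finally show "expectation (\<lambda>\<omega>. W \<omega> * Y \<omega>) = expectation (\<lambda>\<omega>. f \<omega> * Y \<omega>)"
    by (simp add: mult.commute)
  have cross: "integrable M (\<lambda>\<omega>. (E \<omega> * Y \<omega>) * (f \<omega> * Y \<omega>))"
    using EY f(2) by (intro integrable_mult_of_squares) auto
  \<comment> \<open>The test function \<open>E * Y^2\<close> is \<open>F\<close>-measurable, so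
    \<open>f\<close> may be exchanged for its conditional expectation. Only the second
    \<open>E\<close> is unfolded; the first stays in the test function.\<close>
  have "expectation (\<lambda>\<omega>. (E \<omega> * (Y \<omega>)\<^sup>2) * E \<omega>) = expectation (\<lambda>\<omega>. (E \<omega> * (Y \<omega>)\<^sup>2) * f \<omega>)"
    using cross unfolding E_def[symmetric]
    by (subst (2) E_def, intro real_cond_exp_intg(2)) (auto simp: power2_eq_square ac_simps)
  then have cross_eq: "expectation (\<lambda>\<omega>. (E \<omega> * Y \<omega>) * (f \<omega> * Y \<omega>)) = expectation (\<lambda>\<omega>. (E \<omega> * Y \<omega>)\<^sup>2)"
    by (simp add: power2_eq_square ac_simps)
  have expand: "(Y \<omega>)\<^sup>2 * (f \<omega> - E \<omega>)\<^sup>2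
      = (f \<omega> * Y \<omega>)\<^sup>2 + (E \<omega> * Y \<omega>)\<^sup>2 - 2 * ((E \<omega> * Y \<omega>) * (f \<omega> * Y \<omega>))" for \<omega>
    by (simp add: power2_eq_square algebra_simps)
  have dev: "integrable M (\<lambda>\<omega>. (Y \<omega>)\<^sup>2 * (f \<omega> - E \<omega>)\<^sup>2)"
    unfolding expand using f(2) EY cross by simp
  have cv: "cond_variance M Y f = real_cond_exp M F (\<lambda>\<omega>. (f \<omega> - E \<omega>)\<^sup>2)"
    by (simp add: cond_variance_def Let_def F_def E_def)
  \<comment> \<open>Testing against \<open>Y^2\<close> asks for integrability of the weighted
    deviation \<open>dev\<close> only, not of \<open>(f - E)^2\<close>.\<close>
  have *: "expectation (\<lambda>\<omega>. cond_variance M Y f \<omega> * (Y \<omega>)\<^sup>2)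
      = expectation (\<lambda>\<omega>. (Y \<omega>)\<^sup>2 * (f \<omega> - E \<omega>)\<^sup>2)"
    unfolding cv using real_cond_exp_intg(2)[OF dev] by (simp add: mult.commute)
  then show "0 \<le> expectation (\<lambda>\<omega>. cond_variance M Y f \<omega> * (Y \<omega>)\<^sup>2)"
    by simp
  have "expectation (\<lambda>\<omega>. (E \<omega> * Y \<omega>)\<^sup>2) = expectation (\<lambda>\<omega>. (W \<omega> * Y \<omega>)\<^sup>2)"
    using EW by (intro integral_cong_AE) auto
  then show "expectation (\<lambda>\<omega>. cond_variance M Y f \<omega> * (Y \<omega>)\<^sup>2)
      = expectation (\<lambda>\<omega>. (f \<omega> * Y \<omega>)\<^sup>2) - expectation (\<lambda>\<omega>. (W \<omega> * Y \<omega>)\<^sup>2)"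
    unfolding * expand using f(2) EY cross by (simp add: cross_eq)
qed

section \<open>Measurability, the joint law and its outcome marginal\<close>

context treatment_model
begin

text \<open>The model gives measurability of \<open>pY\<close> for each fixed treatment. Such slices
  suffice because the treatment space is countable; the coordinates are permuted to put it
  first.\<close>

lemma measurable_sample_spaceI:
  assumes "\<And>a. a \<in> {0, 1} \<Longrightarrow> (\<lambda>(x, y). f (x, a, y)) \<in> measurable (mX \<Otimes>\<^sub>M mY) N"
  shows "f \<in> measurable (sample_space mX mY) N"
proof -
  have "(\<lambda>(a, x, y). f (x, a, y)) \<in> measurable (count_space {0, 1} \<Otimes>\<^sub>M (mX \<Otimes>\<^sub>M mY)) N"
    by (rule measurable_pair_measure_countable1) (use assms in \<open>auto simp: split_beta'\<close>)
  note 1 = this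
  have "(\<lambda>(x, a, y). (a, x, y)) \<in>
      measurable (sample_space mX mY) (count_space {0, 1} \<Otimes>\<^sub>M (mX \<Otimes>\<^sub>M mY))"
    unfolding sample_space_def by measurable
  from measurable_compose[OF this 1] show ?thesis
    by (simp add: split_beta')
qed

lemma measurable_sample_slice:
  assumes "f \<in> measurable (sample_space mX mY) N" "a \<in> {0, 1}"
  shows "(\<lambda>(x, y). f (x, a, y)) \<in> measurable (mX \<Otimes>\<^sub>M mY) N"
proof -
  have "(\<lambda>(x, y). (x, a, y)) \<in> measurable (mX \<Otimes>\<^sub>M mY) (sample_space mX mY)"
    unfolding sample_space_def by measurable (use assms(2) in auto)
  from measurable_compose[OF this assms(1)] show ?thesis
    by (simp add: split_beta')
qed

lemma space_sample_space: "space (sample_space mX mY) = space mX \<times> {0, 1} \<times> space mY"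
  by (simp add: sample_space_def space_pair_measure)

lemma pY_measurable':
  "a \<in> {0, 1} \<Longrightarrow> (\<lambda>z. pY (snd z) (fst z) a) \<in> borel_measurable (mX \<Otimes>\<^sub>M mY)"
  using pY_measurable[of a] by (simp add: split_beta')

lemma policy_measurable: "policy mX \<pi> \<Longrightarrow> a \<in> {0, 1} \<Longrightarrow> \<pi> a \<in> borel_measurable mX"
  unfolding policy_def by blast

lemma policy_nonneg: "policy mX \<pi> \<Longrightarrow> x \<in> space mX \<Longrightarrow> a \<in> {0, 1} \<Longrightarrow> 0 \<le> \<pi> a x"
  unfolding policy_def by blast

lemma policy_det_policy: "a \<in> {0, 1} \<Longrightarrow> policy mX (det_policy a)"
  by (auto simp: policy_def det_policy_def)

lemma joint_density_nonneg:
  assumes "policy mX \<pi>" "x \<in> space mX" "a \<in> {0, 1}" "y \<in> space mY"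
  shows "0 \<le> joint_density pX pY \<pi> (x, a, y)"
  using policy_nonneg[OF assms(1-3)] pX_nonneg[OF assms(2)] pY_nonneg[OF assms(2-4)]
  by (simp add: joint_density_def)

lemma joint_density_measurable:
  assumes "policy mX \<pi>"
  shows "joint_density pX pY \<pi> \<in> borel_measurable (sample_space mX mY)"
proof (rule measurable_sample_spaceI)
  fix a :: nat assume a: "a \<in> {0, 1}"
  note [measurable] = pX_measurable policy_measurable[OF assms a] pY_measurable'[OF a]
  show "(\<lambda>(x, y). joint_density pX pY \<pi> (x, a, y)) \<in> borel_measurable (mX \<Otimes>\<^sub>M mY)"
    unfolding joint_density_def split_beta' fst_conv snd_conv by measurable
qed

text \<open>Tonelli with \<open>y\<close> outermost: an \<open>h\<close> that depends on the outcome
  only leaves the inner integrals, and what remains inside is the outcome density.\<close>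

lemma nn_integral_joint_law:
  fixes h :: "'x \<times> nat \<times> real \<Rightarrow> ennreal"
  assumes \<pi>: "policy mX \<pi>" and h: "h \<in> borel_measurable (sample_space mX mY)"
  shows "(\<integral>\<^sup>+ z. h z \<partial>joint_law mX mY pX pY \<pi>) =
    (\<integral>\<^sup>+ y. (\<Sum>a\<in>{0, 1}. \<integral>\<^sup>+ x. joint_density pX pY \<pi> (x, a, y) * h (x, a, y) \<partial>mX) \<partial>mY)"
proof -
  interpret X: sigma_finite_measure mX by (rule sigma_finite_mX)
  interpret Y: sigma_finite_measure mY by (rule sigma_finite_mY)
  interpret XY: pair_sigma_finite mX mY ..
  interpret A: finite_measure "count_space {0, 1 :: nat}" by (rule finite_measure_count_space) simp
  interpret AY: pair_sigma_finite "count_space {0, 1 :: nat}" mY ..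
  let ?g = "\<lambda>z. ennreal (joint_density pX pY \<pi> z) * h z"
  note [measurable] = joint_density_measurable[OF \<pi>] h
  have g: "?g \<in> borel_measurable (sample_space mX mY)" by measurable
  then have g': "?g \<in> borel_measurable (mX \<Otimes>\<^sub>M count_space {0, 1} \<Otimes>\<^sub>M mY)"
    by (simp add: sample_space_def)
  have slice: "(\<lambda>(x, y). ?g (x, a, y)) \<in> borel_measurable (mX \<Otimes>\<^sub>M mY)" if "a \<in> {0, 1}" for a
    using g that by (rule measurable_sample_slice)
  have slice_x: "(\<lambda>x. \<integral>\<^sup>+ y. ?g (x, a, y) \<partial>mY) \<in> borel_measurable mX" if "a \<in> {0, 1}" for a
    using Y.borel_measurable_nn_integral[OF slice[OF that]] by simp
  have slice_y: "(\<lambda>y. \<integral>\<^sup>+ x. ?g (x, a, y) \<partial>mX) \<in> borel_measurable mY" if "a \<in> {0, 1}" for a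
    using slice[OF that] by (intro X.borel_measurable_nn_integral) (simp add: measurable_pair_swap_iff[of _ mX] split_beta')
  have "(\<integral>\<^sup>+ z. h z \<partial>joint_law mX mY pX pY \<pi>) = (\<integral>\<^sup>+ z. ?g z \<partial>sample_space mX mY)"
    unfolding joint_law_def by (rule nn_integral_density) measurable
  also have "\<dots> = (\<integral>\<^sup>+ x. \<integral>\<^sup>+ z. ?g (x, z) \<partial>(count_space {0, 1} \<Otimes>\<^sub>M mY) \<partial>mX)"
    unfolding sample_space_def using g' by (rule AY.P.nn_integral_fst[symmetric])
  also have "\<dots> = (\<integral>\<^sup>+ x. (\<Sum>a\<in>{0, 1}. \<integral>\<^sup>+ y. ?g (x, a, y) \<partial>mY) \<partial>mX)"
  proof (rule nn_integral_cong)
    fix x assume "x \<in> space mX"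
    then have "(\<lambda>z. ?g (x, z)) \<in> borel_measurable (count_space {0, 1} \<Otimes>\<^sub>M mY)"
      by (rule measurable_Pair2[OF g'])
    then show "(\<integral>\<^sup>+ z. ?g (x, z) \<partial>(count_space {0, 1} \<Otimes>\<^sub>M mY)) = (\<Sum>a\<in>{0, 1}. \<integral>\<^sup>+ y. ?g (x, a, y) \<partial>mY)"
      by (subst Y.nn_integral_fst[symmetric]) (auto simp: nn_integral_count_space_finite)
  qed
  also have "\<dots> = (\<Sum>a\<in>{0, 1}. \<integral>\<^sup>+ x. \<integral>\<^sup>+ y. ?g (x, a, y) \<partial>mY \<partial>mX)"
    using slice_x by (intro nn_integral_sum) auto
  also have "\<dots> = (\<Sum>a\<in>{0, 1}. \<integral>\<^sup>+ y. \<integral>\<^sup>+ x. ?g (x, a, y) \<partial>mX \<partial>mY)"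
    using slice by (intro sum.cong refl XY.Fubini'[symmetric]) auto
  also have "\<dots> = (\<integral>\<^sup>+ y. (\<Sum>a\<in>{0, 1}. \<integral>\<^sup>+ x. ?g (x, a, y) \<partial>mX) \<partial>mY)"
    using slice_y by (intro nn_integral_sum[symmetric]) auto
  finally show ?thesis .
qed

(* Unlike outcome_density, this takes the value infinity, not 0, where the integral diverges. *)
definition outcome_nn_density :: "(nat \<Rightarrow> 'x \<Rightarrow> real) \<Rightarrow> real \<Rightarrow> ennreal" where
  "outcome_nn_density \<pi> y = (\<Sum>a\<in>{0, 1}. \<integral>\<^sup>+ x. joint_density pX pY \<pi> (x, a, y) \<partial>mX)"

lemma joint_density_measurable_xy:
  assumes \<pi>: "policy mX \<pi>" and a: "a \<in> {0, 1}"
  shows "(\<lambda>z. joint_density pX pY \<pi> (fst z, a, snd z)) \<in> borel_measurable (mX \<Otimes>\<^sub>M mY)"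
  using measurable_sample_slice[OF joint_density_measurable[OF \<pi>] a] by (simp add: split_beta')

lemma joint_density_measurable_x:
  assumes \<pi>: "policy mX \<pi>" and a: "a \<in> {0, 1}" and y: "y \<in> space mY"
  shows "(\<lambda>x. joint_density pX pY \<pi> (x, a, y)) \<in> borel_measurable mX"
  using measurable_Pair1[OF joint_density_measurable_xy[OF \<pi> a] y] by simp

lemma outcome_nn_density_measurable [measurable]:
  assumes "policy mX \<pi>"
  shows "outcome_nn_density \<pi> \<in> borel_measurable mY"
proof -
  interpret X: sigma_finite_measure mX by (rule sigma_finite_mX)
  show ?thesis
    unfolding outcome_nn_density_def[abs_def] using joint_density_measurable_xy[OF assms]
    by (intro borel_measurable_sum X.borel_measurable_nn_integral)
      (simp add: measurable_pair_swap_iff[of _ mX] split_beta')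
qed

text \<open>Valid at every \<open>y\<close>: where the integral diverges, the Bochner integral and
  \<open>enn2real\<close> of infinity are both 0.\<close>

lemma outcome_density_eq:
  assumes \<pi>: "policy mX \<pi>" and y: "y \<in> space mY"
  shows "outcome_density mX pX pY \<pi> y = enn2real (outcome_nn_density \<pi> y)"
proof -
  have nonneg: "0 \<le> joint_density pX pY \<pi> (x, a, y)" if "x \<in> space mX" "a \<in> {0, 1}" for x a
    using joint_density_nonneg[OF \<pi> that y] .
  note [measurable] = joint_density_measurable_x[OF \<pi> _ y]
  have "outcome_density mX pX pY \<pi> y
      = enn2real (\<integral>\<^sup>+ x. ennreal (\<Sum>a\<in>{0, 1}. joint_density pX pY \<pi> (x, a, y)) \<partial>mX)"
    unfolding outcome_density_def using nonneg
    by (intro integral_eq_nn_integral) (auto intro!: borel_measurable_sum AE_I2)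
  also have "(\<integral>\<^sup>+ x. ennreal (\<Sum>a\<in>{0, 1}. joint_density pX pY \<pi> (x, a, y)) \<partial>mX)
      = (\<integral>\<^sup>+ x. (\<Sum>a\<in>{0, 1}. ennreal (joint_density pX pY \<pi> (x, a, y))) \<partial>mX)"
    using nonneg by (intro nn_integral_cong sum_ennreal[symmetric]) auto
  also have "\<dots> = outcome_nn_density \<pi> y"
    unfolding outcome_nn_density_def by (intro nn_integral_sum) auto
  finally show ?thesis .
qed

text \<open>Identifies \<open>outcome_nn_density \<pi>\<close> as the density of the outcome
  marginal with respect to \<open>mY\<close>.\<close>

lemma nn_integral_outcome:
  assumes \<pi>: "policy mX \<pi>" and h: "h \<in> borel_measurable mY"
  shows "(\<integral>\<^sup>+ z. h (snd (snd z)) \<partial>joint_law mX mY pX pY \<pi>) = (\<integral>\<^sup>+ y. outcome_nn_density \<pi> y * h y \<partial>mY)"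
proof -
  have "(\<lambda>z. h (snd (snd z))) \<in> borel_measurable (sample_space mX mY)"
    unfolding sample_space_def using h by measurable
  then have "(\<integral>\<^sup>+ z. h (snd (snd z)) \<partial>joint_law mX mY pX pY \<pi>)
      = (\<integral>\<^sup>+ y. (\<Sum>a\<in>{0, 1}. \<integral>\<^sup>+ x. joint_density pX pY \<pi> (x, a, y) * h y \<partial>mX) \<partial>mY)"
    by (subst nn_integral_joint_law[OF \<pi>]) simp_all
  also have "\<dots> = (\<integral>\<^sup>+ y. outcome_nn_density \<pi> y * h y \<partial>mY)"
  proof (rule nn_integral_cong)
    fix y assume "y \<in> space mY"
    note [measurable] = joint_density_measurable_x[OF \<pi> _ this]
    show "(\<Sum>a\<in>{0, 1}. \<integral>\<^sup>+ x. joint_density pX pY \<pi> (x, a, y) * h y \<partial>mX)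
        = outcome_nn_density \<pi> y * h y"
      unfolding outcome_nn_density_def sum_distrib_right
      by (intro sum.cong refl nn_integral_multc) auto
  qed
  finally show ?thesis .
qed

text \<open>The normalizations of \<open>pY\<close>, of the policy and of \<open>pX\<close> are used
  in this order, from the inside out. Since \<open>nn_integral_joint_law\<close> has
  \<open>y\<close> outermost, \<open>swap\<close> interchanges the integrals before \<open>y\<close>
  is integrated out.\<close>

lemma prob_space_joint_law:
  assumes \<pi>: "policy mX \<pi>"
  shows "prob_space (joint_law mX mY pX pY \<pi>)"
proof
  interpret X: sigma_finite_measure mX by (rule sigma_finite_mX)
  interpret Y: sigma_finite_measure mY by (rule sigma_finite_mY)
  interpret XY: pair_sigma_finite mX mY ..
  note [measurable] = joint_density_measurable_xy[OF \<pi>] pX_measurable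
    policy_measurable[OF \<pi>, of 0] policy_measurable[OF \<pi>, of 1, simplified]
  have swap: "(\<integral>\<^sup>+ y. \<integral>\<^sup>+ x. joint_density pX pY \<pi> (x, a, y) \<partial>mX \<partial>mY)
      = (\<integral>\<^sup>+ x. ennreal (\<pi> a x) * ennreal (pX x) \<partial>mX)" if a: "a \<in> {0, 1}" for a
  proof -
    have "(\<integral>\<^sup>+ y. \<integral>\<^sup>+ x. joint_density pX pY \<pi> (x, a, y) \<partial>mX \<partial>mY)
        = (\<integral>\<^sup>+ x. \<integral>\<^sup>+ y. joint_density pX pY \<pi> (x, a, y) \<partial>mY \<partial>mX)"
      using joint_density_measurable_xy[OF \<pi> a] by (intro XY.Fubini') (simp add: split_beta')
    also have "\<dots> = (\<integral>\<^sup>+ x. ennreal (\<pi> a x) * ennreal (pX x) \<partial>mX)"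
    proof (rule nn_integral_cong)
      fix x assume x: "x \<in> space mX"
      have [measurable]: "(\<lambda>y. pY y x a) \<in> borel_measurable mY"
        using measurable_Pair2[OF pY_measurable'[OF a] x] by simp
      have "(\<integral>\<^sup>+ y. joint_density pX pY \<pi> (x, a, y) \<partial>mY)
          = (\<integral>\<^sup>+ y. ennreal (pY y x a) * (ennreal (\<pi> a x) * ennreal (pX x)) \<partial>mY)"
      proof (rule nn_integral_cong)
        fix y assume "y \<in> space mY"
        then have "0 \<le> pY y x a" by (rule pY_nonneg[OF x a])
        moreover have "0 \<le> \<pi> a x" using \<pi> x a by (rule policy_nonneg)
        ultimately show "ennreal (joint_density pX pY \<pi> (x, a, y))
            = ennreal (pY y x a) * (ennreal (\<pi> a x) * ennreal (pX x))"
          by (simp add: joint_density_def ennreal_mult' mult.assoc)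
      qed
      also have "\<dots> = ennreal (\<pi> a x) * ennreal (pX x)"
        using pY_normalized[OF x a] by (subst nn_integral_multc) auto
      finally show "(\<integral>\<^sup>+ y. joint_density pX pY \<pi> (x, a, y) \<partial>mY) = ennreal (\<pi> a x) * ennreal (pX x)" .
    qed
    finally show ?thesis .
  qed
  have "emeasure (joint_law mX mY pX pY \<pi>) (space (joint_law mX mY pX pY \<pi>))
      = (\<integral>\<^sup>+ z. 1 \<partial>joint_law mX mY pX pY \<pi>)"
    by simp
  also have "\<dots> = (\<integral>\<^sup>+ y. (\<Sum>a\<in>{0, 1}. \<integral>\<^sup>+ x. joint_density pX pY \<pi> (x, a, y) \<partial>mX) \<partial>mY)"
    by (subst nn_integral_joint_law[OF \<pi>]) auto
  also have "\<dots> = (\<Sum>a\<in>{0, 1}. \<integral>\<^sup>+ y. \<integral>\<^sup>+ x. joint_density pX pY \<pi> (x, a, y) \<partial>mX \<partial>mY)"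
    using joint_density_measurable_xy[OF \<pi>]
    by (intro nn_integral_sum X.borel_measurable_nn_integral)
      (simp add: measurable_pair_swap_iff[of _ mX] split_beta')
  also have "\<dots> = (\<integral>\<^sup>+ x. (\<Sum>a\<in>{0, 1}. ennreal (\<pi> a x) * ennreal (pX x)) \<partial>mX)"
    by (subst nn_integral_sum) (auto simp: swap)
  also have "\<dots> = (\<integral>\<^sup>+ x. ennreal (pX x) \<partial>mX)"
  proof (rule nn_integral_cong)
    fix x assume "x \<in> space mX"
    then have "(\<Sum>a\<in>{0, 1}. \<pi> a x) = 1" "0 \<le> \<pi> 0 x" "0 \<le> \<pi> 1 x"
      using \<pi> unfolding policy_def by blast+
    then show "(\<Sum>a\<in>{0, 1}. ennreal (\<pi> a x) * ennreal (pX x)) = ennreal (pX x)"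
      by (simp add: distrib_right[symmetric] ennreal_plus[symmetric] del: ennreal_plus)
  qed
  also have "\<dots> = 1" by (rule pX_normalized)
  finally show "emeasure (joint_law mX mY pX pY \<pi>) (space (joint_law mX mY pX pY \<pi>)) = 1" .
qed

text \<open>The total mass is 1. Off the exceptional null set \<open>enn2real\<close> loses nothing,
  so the quotient of real densities can be cancelled.\<close>

lemma outcome_nn_density_finite:
  assumes "policy mX \<pi>"
  shows "AE y in mY. outcome_nn_density \<pi> y \<noteq> \<infinity>"
proof (rule nn_integral_PInf_AE)
  interpret prob_space "joint_law mX mY pX pY \<pi>" by (rule prob_space_joint_law) fact
  show "(\<integral>\<^sup>+ y. outcome_nn_density \<pi> y \<partial>mY) \<noteq> \<infinity>"
    using nn_integral_outcome[OF assms, of "\<lambda>_. 1"] emeasure_space_1 by simp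
qed (simp add: outcome_nn_density_measurable assms)

text \<open>Both joint densities contain the factor \<open>pY * pX\<close>, and under
  \<open>\<pi>b\<close> the remaining factor is positive; a vanishing integral therefore forces
  \<open>pY * pX\<close> to vanish for almost every covariate. This makes the convention for
  division by zero harmless in \<open>outcome_ratio\<close>.\<close>

lemma outcome_nn_density_eq_0:
  assumes \<pi>: "policy mX \<pi>" and y: "y \<in> space mY" and "outcome_nn_density \<pi>b y = 0"
  shows "outcome_nn_density \<pi> y = 0"
proof -
  have "(\<integral>\<^sup>+ x. joint_density pX pY \<pi> (x, a, y) \<partial>mX) = 0" if a: "a \<in> {0, 1}" for a
  proof -
    have "(\<integral>\<^sup>+ x. joint_density pX pY \<pi>b (x, a, y) \<partial>mX) = 0"
      using assms(3) a by (auto simp: outcome_nn_density_def)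
    then have "AE x in mX. ennreal (joint_density pX pY \<pi>b (x, a, y)) = 0"
      using joint_density_measurable_x[OF policy_\<pi>b a y] by (subst (asm) nn_integral_0_iff_AE) auto
    then have "AE x in mX. ennreal (joint_density pX pY \<pi> (x, a, y)) = 0"
      using AE_space
    proof eventually_elim
      case (elim x)
      then have "joint_density pX pY \<pi>b (x, a, y) = 0"
        using joint_density_nonneg[OF policy_\<pi>b elim(2) a y] by simp
      then have "pY y x a * pX x = 0"
        using support[OF elim(2) a] by (auto simp: joint_density_def)
      then show ?case
        by (auto simp: joint_density_def)
    qed
    then show ?thesis
      using joint_density_measurable_x[OF \<pi> a y] by (subst nn_integral_0_iff_AE) auto
  qed
  then show ?thesis
    by (simp add: outcome_nn_density_def)
qed

section \<open>Importance ratios and their conditional expectations given the outcome\<close>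

text \<open>For a policy \<open>\<pi>\<close>, the Radon-Nikodym derivative of the law under
  \<open>\<pi>\<close> with respect to the law under \<open>\<pi>b\<close>;
  \<open>outcome_ratio\<close> is its counterpart for the outcome marginals.\<close>

definition policy_ratio :: "(nat \<Rightarrow> 'x \<Rightarrow> real) \<Rightarrow> 'x \<times> nat \<times> real \<Rightarrow> real" where
  "policy_ratio \<pi> = (\<lambda>(x, a, y). \<pi> a x / \<pi>b a x)"

definition outcome_ratio :: "(nat \<Rightarrow> 'x \<Rightarrow> real) \<Rightarrow> real \<Rightarrow> real" where
  "outcome_ratio \<pi> y = outcome_density mX pX pY \<pi> y / outcome_density mX pX pY \<pi>b y"

lemma policy_ratio_measurable:
  assumes \<pi>: "policy mX \<pi>"
  shows "policy_ratio \<pi> \<in> borel_measurable (sample_space mX mY)"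
proof (rule measurable_sample_spaceI)
  fix a :: nat assume a: "a \<in> {0, 1}"
  note [measurable] = policy_measurable[OF \<pi> a] policy_measurable[OF policy_\<pi>b a]
  show "(\<lambda>(x, y). policy_ratio \<pi> (x, a, y)) \<in> borel_measurable (mX \<Otimes>\<^sub>M mY)"
    unfolding policy_ratio_def split_beta' fst_conv snd_conv by measurable
qed

lemma outcome_ratio_measurable:
  assumes \<pi>: "policy mX \<pi>"
  shows "outcome_ratio \<pi> \<in> borel_measurable mY"
proof -
  note [measurable] = outcome_nn_density_measurable[OF \<pi>] outcome_nn_density_measurable[OF policy_\<pi>b]
  have "outcome_ratio \<pi> \<in> borel_measurable mY \<longleftrightarrow>
      (\<lambda>y. enn2real (outcome_nn_density \<pi> y) / enn2real (outcome_nn_density \<pi>b y)) \<in> borel_measurable mY"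
    by (rule measurable_cong) (simp add: outcome_ratio_def outcome_density_eq \<pi> policy_\<pi>b)
  then show ?thesis by simp
qed

text \<open>Positivity of \<open>\<pi>b\<close> lets the ratio cancel pointwise, which leaves the
  law under \<open>\<pi>\<close>. The result is an integral over \<open>mY\<close> so that the
  outcome ratio can be matched with it.\<close>

lemma nn_integral_policy_ratio:
  assumes \<pi>: "policy mX \<pi>" and h: "h \<in> borel_measurable mY"
  shows "(\<integral>\<^sup>+ z. ennreal (policy_ratio \<pi> z) * h (snd (snd z)) \<partial>joint_law mX mY pX pY \<pi>b)
    = (\<integral>\<^sup>+ y. outcome_nn_density \<pi> y * h y \<partial>mY)"
proof -
  have h' [measurable]: "(\<lambda>z. h (snd (snd z))) \<in> borel_measurable (sample_space mX mY)"
    unfolding sample_space_def using h by measurable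
  note [measurable] = policy_ratio_measurable[OF \<pi>]
  have "(\<integral>\<^sup>+ z. ennreal (policy_ratio \<pi> z) * h (snd (snd z)) \<partial>joint_law mX mY pX pY \<pi>b)
      = (\<integral>\<^sup>+ y. (\<Sum>a\<in>{0, 1}. \<integral>\<^sup>+ x. joint_density pX pY \<pi>b (x, a, y) *
          (ennreal (policy_ratio \<pi> (x, a, y)) * h (snd (snd (x, a, y)))) \<partial>mX) \<partial>mY)"
    by (rule nn_integral_joint_law[OF policy_\<pi>b]) measurable
  also have "\<dots> = (\<integral>\<^sup>+ y. (\<Sum>a\<in>{0, 1}. \<integral>\<^sup>+ x. joint_density pX pY \<pi> (x, a, y) *
      h (snd (snd (x, a, y))) \<partial>mX) \<partial>mY)"
  proof (intro nn_integral_cong sum.cong refl)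
    fix x a y assume *: "y \<in> space mY" "a \<in> {0, 1 :: nat}" "x \<in> space mX"
    have "joint_density pX pY \<pi>b (x, a, y) * policy_ratio \<pi> (x, a, y) = joint_density pX pY \<pi> (x, a, y)"
      using support[OF *(3,2)] by (simp add: joint_density_def policy_ratio_def)
    then show "joint_density pX pY \<pi>b (x, a, y) *
          (ennreal (policy_ratio \<pi> (x, a, y)) * h (snd (snd (x, a, y))))
        = ennreal (joint_density pX pY \<pi> (x, a, y)) * h (snd (snd (x, a, y)))"
      using joint_density_nonneg[OF policy_\<pi>b *(3,2,1)]
      by (simp add: mult.assoc[symmetric] ennreal_mult'[symmetric])
  qed
  also have "\<dots> = (\<integral>\<^sup>+ z. h (snd (snd z)) \<partial>joint_law mX mY pX pY \<pi>)"
    by (rule nn_integral_joint_law[OF \<pi> h', symmetric])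
  also have "\<dots> = (\<integral>\<^sup>+ y. outcome_nn_density \<pi> y * h y \<partial>mY)"
    by (rule nn_integral_outcome[OF \<pi> h])
  finally show ?thesis .
qed

text \<open>Here the cancellation is between marginal densities and is shown almost everywhere: both
  densities have to be finite, and where the denominator is zero both integrands vanish.\<close>

lemma nn_integral_outcome_ratio:
  assumes \<pi>: "policy mX \<pi>" and h [measurable]: "h \<in> borel_measurable mY"
  shows "(\<integral>\<^sup>+ z. ennreal (outcome_ratio \<pi> (snd (snd z))) * h (snd (snd z)) \<partial>joint_law mX mY pX pY \<pi>b)
    = (\<integral>\<^sup>+ y. outcome_nn_density \<pi> y * h y \<partial>mY)"
proof -
  note [measurable] = outcome_ratio_measurable[OF \<pi>]
  have "(\<integral>\<^sup>+ z. ennreal (outcome_ratio \<pi> (snd (snd z))) * h (snd (snd z)) \<partial>joint_law mX mY pX pY \<pi>b)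
      = (\<integral>\<^sup>+ y. outcome_nn_density \<pi>b y * (ennreal (outcome_ratio \<pi> y) * h y) \<partial>mY)"
    by (rule nn_integral_outcome[OF policy_\<pi>b]) measurable
  also have "\<dots> = (\<integral>\<^sup>+ y. outcome_nn_density \<pi> y * h y \<partial>mY)"
  proof (rule nn_integral_cong_AE)
    show "AE y in mY. outcome_nn_density \<pi>b y * (ennreal (outcome_ratio \<pi> y) * h y)
        = outcome_nn_density \<pi> y * h y"
      using outcome_nn_density_finite[OF \<pi>] outcome_nn_density_finite[OF policy_\<pi>b] AE_space
    proof eventually_elim
      case (elim y)
      show ?case
      proof (cases "outcome_nn_density \<pi>b y = 0")
        case True
        then show ?thesis
          using outcome_nn_density_eq_0[OF \<pi> elim(3)] by simp
      next
        case False
        obtain p q where pq: "0 \<le> p" "outcome_nn_density \<pi>b y = ennreal p"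
            "0 \<le> q" "outcome_nn_density \<pi> y = ennreal q"
          using elim(1,2) by (metis ennreal_cases infinity_ennreal_def)
        with False have "p \<noteq> 0" by auto
        then have "outcome_nn_density \<pi>b y * ennreal (outcome_ratio \<pi> y) = outcome_nn_density \<pi> y"
          using pq elim(3) by (simp add: outcome_ratio_def outcome_density_eq \<pi> policy_\<pi>b ennreal_mult'[symmetric])
        then show ?thesis by (simp add: mult.assoc[symmetric])
      qed
    qed
  qed
  finally show ?thesis .
qed

lemma space_joint_law: "space (joint_law mX mY pX pY \<pi>) = space mX \<times> {0, 1} \<times> space mY"
  by (simp add: joint_law_def space_sample_space)

lemma measurable_joint_law: "measurable (joint_law mX mY pX pY \<pi>) N = measurable (sample_space mX mY) N"
  by (simp add: joint_law_def cong: measurable_cong_sets)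

lemma outcome_measurable_mY: "(\<lambda>z. snd (snd z)) \<in> measurable (joint_law mX mY pX pY \<pi>) mY"
  unfolding measurable_joint_law sample_space_def by measurable

lemma id_measurable_mY: "(\<lambda>y. y) \<in> borel_measurable mY"
  by (rule measurable_cong_sets[OF sets_mY refl, THEN equalityD2, THEN subsetD])
    (rule measurable_restrict_space1, simp)

lemma outcome_measurable: "(\<lambda>z. snd (snd z)) \<in> borel_measurable (joint_law mX mY pX pY \<pi>)"
  using measurable_compose[OF outcome_measurable_mY id_measurable_mY] .

text \<open>A set in the sigma-algebra of the outcome is the preimage of a Borel set
  \<open>B\<close>, so its indicator is a function of the outcome. Over it, both ratios integrate to
  the probability of \<open>B\<close> under the outcome law of \<open>\<pi>\<close>.\<close>

lemma cond_exp_policy_ratio: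
  assumes \<pi>: "policy mX \<pi>"
  defines "P \<equiv> joint_law mX mY pX pY \<pi>b"
  shows "integrable P (policy_ratio \<pi>)"
    and "AE z in P. real_cond_exp P (vimage_algebra (space P) (\<lambda>z. snd (snd z)) borel) (policy_ratio \<pi>) z
      = outcome_ratio \<pi> (snd (snd z))"
proof -
  let ?Y = "\<lambda>z :: 'x \<times> nat \<times> real. snd (snd z)"
  define F where "F = vimage_algebra (space P) ?Y borel"
  interpret P: prob_space P
    unfolding P_def by (rule prob_space_joint_law[OF policy_\<pi>b])
  have [measurable]: "?Y \<in> borel_measurable P"
    unfolding P_def by (rule outcome_measurable)
  have "subalgebra P F"
    unfolding F_def subalgebra_def by (auto simp: sets_vimage_algebra intro!: sets.sigma_sets_subset)
  then interpret finite_measure_subalgebra P F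
    by unfold_locales
  \<comment> \<open>\<open>F\<close> is generated by the outcome as a real-valued map, while
    \<open>outcome_ratio\<close> is measurable on \<open>mY\<close>; the two fit together because
    \<open>mY\<close> carries the trace of the Borel sets on its space.\<close>
  have YF: "?Y \<in> measurable F mY"
  proof -
    have "?Y \<in> measurable F (restrict_space borel (space mY))"
    proof (rule measurable_restrict_space2)
      show "?Y \<in> space F \<rightarrow> space mY"
        by (auto simp: F_def P_def space_joint_law)
      show "?Y \<in> borel_measurable F"
        unfolding F_def by (rule measurable_vimage_algebra1) auto
    qed
    then show ?thesis
      using measurable_cong_sets[OF refl sets_mY] by blast
  qed
  have WF: "(\<lambda>z. outcome_ratio \<pi> (?Y z)) \<in> borel_measurable F"
    using measurable_compose[OF YF outcome_ratio_measurable[OF \<pi>]] .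
  have WP [measurable]: "(\<lambda>z. outcome_ratio \<pi> (?Y z)) \<in> borel_measurable P"
    by (rule measurable_from_subalg[OF subalg WF])
  have RP [measurable]: "policy_ratio \<pi> \<in> borel_measurable P"
    unfolding P_def measurable_joint_law by (rule policy_ratio_measurable[OF \<pi>])
  have R0: "0 \<le> policy_ratio \<pi> z" if "z \<in> space P" for z
    using that policy_nonneg[OF \<pi>] policy_nonneg[OF policy_\<pi>b]
    by (auto simp: P_def space_joint_law policy_ratio_def)
  have W0: "0 \<le> outcome_ratio \<pi> (?Y z)" if "z \<in> space P" for z
    using that by (auto simp: P_def space_joint_law outcome_ratio_def outcome_density_eq \<pi> policy_\<pi>b)
  \<comment> \<open>This number is the mean of either ratio under \<open>\<pi>b\<close>, which makes
    both integrable.\<close>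
  have total: "(\<integral>\<^sup>+ y. outcome_nn_density \<pi> y * 1 \<partial>mY) = 1"
  proof -
    interpret prob_space "joint_law mX mY pX pY \<pi>"
      by (rule prob_space_joint_law[OF \<pi>])
    show ?thesis
      using nn_integral_outcome[OF \<pi>, of "\<lambda>_. 1"] emeasure_space_1 by simp
  qed
  have "(\<integral>\<^sup>+ z. ennreal (policy_ratio \<pi> z) \<partial>P) < \<infinity>"
    using nn_integral_policy_ratio[OF \<pi>, of "\<lambda>_. 1"] total by (simp add: P_def)
  with R0 show R: "integrable P (policy_ratio \<pi>)"
    by (intro integrableI_nonneg) auto
  have "(\<integral>\<^sup>+ z. ennreal (outcome_ratio \<pi> (?Y z)) \<partial>P) < \<infinity>"
    using nn_integral_outcome_ratio[OF \<pi>, of "\<lambda>_. 1"] total by (simp add: P_def)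
  with W0 have W: "integrable P (\<lambda>z. outcome_ratio \<pi> (?Y z))"
    by (intro integrableI_nonneg) auto
  have "AE z in P. real_cond_exp P F (policy_ratio \<pi>) z = outcome_ratio \<pi> (?Y z)"
  proof (rule real_cond_exp_charact[OF _ R W WF])
    fix A assume "A \<in> sets F"
    then obtain B where B [measurable]: "B \<in> sets borel" and A: "A = ?Y -` B \<inter> space P"
      unfolding F_def by (subst (asm) sets_vimage_algebra2) auto
    have [measurable]: "A \<in> sets P"
      unfolding A by measurable
    have hB: "(\<lambda>y. indicator B y) \<in> borel_measurable mY"
      using id_measurable_mY by (rule measurable_compose) simp
    \<comment> \<open>Nonnegativity brings both set integrals into the form of the reweighting
      identities, with \<open>h\<close> the indicator of \<open>B\<close>.\<close>
    have set_integral: "(LINT z:A|P. g z) = enn2real (\<integral>\<^sup>+ z. ennreal (g z) * indicator B (?Y z) \<partial>P)"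
      if [measurable]: "g \<in> borel_measurable P" and "\<And>z. z \<in> space P \<Longrightarrow> 0 \<le> g z" for g
    proof -
      have "(LINT z:A|P. g z) = enn2real (\<integral>\<^sup>+ z. ennreal (indicator A z *\<^sub>R g z) \<partial>P)"
        unfolding set_lebesgue_integral_def using that(2)
        by (intro integral_eq_nn_integral) (auto intro!: AE_I2)
      also have "(\<integral>\<^sup>+ z. ennreal (indicator A z *\<^sub>R g z) \<partial>P)
          = (\<integral>\<^sup>+ z. ennreal (g z) * indicator B (?Y z) \<partial>P)"
        by (intro nn_integral_cong) (auto simp: A indicator_def)
      finally show ?thesis .
    qed
    show "(LINT z:A|P. policy_ratio \<pi> z) = (LINT z:A|P. outcome_ratio \<pi> (?Y z))"
      using nn_integral_policy_ratio[OF \<pi> hB] nn_integral_outcome_ratio[OF \<pi> hB]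
      by (simp add: set_integral R0 W0 P_def[symmetric])
  qed
  then show "AE z in P. real_cond_exp P (vimage_algebra (space P) ?Y borel) (policy_ratio \<pi>) z
      = outcome_ratio \<pi> (?Y z)"
    by (simp add: F_def)
qed

lemma rho_ATE_eq_policy_ratio_diff:
  "(\<lambda>(x, a, y). rho_ATE \<pi>b a x) = (\<lambda>z. policy_ratio (det_policy 1) z - policy_ratio (det_policy 0) z)"
  by (auto simp: rho_ATE_def policy_ratio_def det_policy_def diff_divide_distrib)

lemma w_ATE_eq_outcome_ratio_diff:
  "w_ATE mX pX pY \<pi>b y = outcome_ratio (det_policy 1) y - outcome_ratio (det_policy 0) y"
  by (simp add: w_ATE_def outcome_ratio_def diff_divide_distrib)

lemma cond_exp_rho_ATE:
  defines "P \<equiv> joint_law mX mY pX pY \<pi>b"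
  shows "integrable P (\<lambda>(x, a, y). rho_ATE \<pi>b a x)"
    and "AE z in P. real_cond_exp P (vimage_algebra (space P) (\<lambda>z. snd (snd z)) borel)
      (\<lambda>(x, a, y). rho_ATE \<pi>b a x) z = w_ATE mX pX pY \<pi>b (snd (snd z))"
proof -
  let ?F = "vimage_algebra (space P) (\<lambda>z. snd (snd z)) (borel :: real measure)"
  interpret P: prob_space P
    unfolding P_def by (rule prob_space_joint_law[OF policy_\<pi>b])
  have [measurable]: "(\<lambda>z. snd (snd z)) \<in> borel_measurable P"
    unfolding P_def by (rule outcome_measurable)
  have "subalgebra P ?F"
    unfolding subalgebra_def by (auto simp: sets_vimage_algebra intro!: sets.sigma_sets_subset)
  then interpret finite_measure_subalgebra P ?F
    by unfold_locales
  note 0 = cond_exp_policy_ratio[OF policy_det_policy[of 0], folded P_def, simplified]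
  note 1 = cond_exp_policy_ratio[OF policy_det_policy[of 1], folded P_def, simplified]
  show "integrable P (\<lambda>(x, a, y). rho_ATE \<pi>b a x)"
    unfolding rho_ATE_eq_policy_ratio_diff using 0(1) 1(1) by simp
  show "AE z in P. real_cond_exp P ?F (\<lambda>(x, a, y). rho_ATE \<pi>b a x) z
      = w_ATE mX pX pY \<pi>b (snd (snd z))"
    unfolding rho_ATE_eq_policy_ratio_diff w_ATE_eq_outcome_ratio_diff
    using real_cond_exp_diff[OF 1(1) 0(1)] 0(2) 1(2) by eventually_elim simp
qed

end

section \<open>Comparison of the two sample means\<close>

theorem propositionE1:
  fixes M :: "'w measure"
    and mX :: "'x measure" and mY :: "real measure"
    and pX :: "'x \<Rightarrow> real" and pY :: "real \<Rightarrow> 'x \<Rightarrow> nat \<Rightarrow> real"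
    and \<pi>b :: "nat \<Rightarrow> 'x \<Rightarrow> real"
    and n :: nat and D :: "nat \<Rightarrow> 'w \<Rightarrow> 'x \<times> nat \<times> real"
  defines "P \<equiv> joint_law mX mY pX pY \<pi>b"
  assumes model: "treatment_model mX mY pX pY \<pi>b"
    and prob_M: "prob_space M"
    and n_pos: "1 \<le> n"
    and indep: "prob_space.indep_vars M (\<lambda>_. sample_space mX mY) D {1..n}"
    and ident: "\<And>i. i \<in> {1..n} \<Longrightarrow>
      distributed M (sample_space mX mY) (D i) (\<lambda>z. ennreal (joint_density pX pY \<pi>b z))"
    and finite_var: "integrable M (\<lambda>\<omega>. (ATE_IPW \<pi>b n D \<omega>)\<^sup>2)"
  shows "prob_space.variance M (ATE_MR mX pX pY \<pi>b n D)
           \<le> prob_space.variance M (ATE_IPW \<pi>b n D) \<and>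
         prob_space.variance M (ATE_IPW \<pi>b n D) - prob_space.variance M (ATE_MR mX pX pY \<pi>b n D)
           = 1 / real n * (LINT (x, a, y)|P.
               cond_variance P (\<lambda>(x, a, y). y) (\<lambda>(x, a, y). rho_ATE \<pi>b a x) (x, a, y) * y\<^sup>2) \<and>
         0 \<le> 1 / real n * (LINT (x, a, y)|P.
               cond_variance P (\<lambda>(x, a, y). y) (\<lambda>(x, a, y). rho_ATE \<pi>b a x) (x, a, y) * y\<^sup>2)"
proof -
  interpret treatment_model mX mY pX pY \<pi>b by (rule model)
  interpret M: prob_space M by (rule prob_M)
  interpret P: prob_space P
    unfolding P_def by (rule prob_space_joint_law[OF policy_\<pi>b])
  let ?Y = "\<lambda>(x, a, y). y :: real"
  let ?\<rho> = "\<lambda>(x, a, y). rho_ATE \<pi>b a x"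
  let ?w = "\<lambda>z. w_ATE mX pX pY \<pi>b (?Y z)"
  have Y_eq: "?Y = (\<lambda>z. snd (snd z))"
    by auto
  have Y: "?Y \<in> borel_measurable P"
    unfolding Y_eq P_def by (rule outcome_measurable)
  have \<rho>: "integrable P ?\<rho>"
    and cond: "AE z in P. real_cond_exp P (vimage_algebra (space P) ?Y borel) ?\<rho> z = ?w z"
    using cond_exp_rho_ATE unfolding Y_eq P_def by auto
  have w: "?w \<in> borel_measurable P"
    unfolding w_ATE_eq_outcome_ratio_diff unfolding Y_eq P_def
    by (intro borel_measurable_diff measurable_compose[OF outcome_measurable_mY]
        outcome_ratio_measurable policy_det_policy) auto
  have f: "(\<lambda>z. ?\<rho> z * ?Y z) \<in> borel_measurable (sample_space mX mY)"
    and g: "(\<lambda>z. ?w z * ?Y z) \<in> borel_measurable (sample_space mX mY)"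
    using borel_measurable_times[OF borel_measurable_integrable[OF \<rho>] Y]
      borel_measurable_times[OF w Y]
    unfolding P_def measurable_joint_law .
  have distr: "distr M (sample_space mX mY) (D i) = P" if "i \<in> {1..n}" for i
    using distributed_distr_eq_density[OF ident[OF that]] by (simp add: P_def joint_law_def)
  have D: "D i \<in> measurable M (sample_space mX mY)" if "i \<in> {1..n}" for i
    using distributed_measurable[OF ident[OF that]] .
  have one_in: "1 \<in> {1..n}"
    using n_pos by simp
  have IPW: "ATE_IPW \<pi>b n D = (\<lambda>\<omega>. 1 / real n * (\<Sum>i=1..n. ?\<rho> (D i \<omega>) * ?Y (D i \<omega>)))"
    by (simp add: ATE_IPW_def fun_eq_iff split_beta')
  have MR: "ATE_MR mX pX pY \<pi>b n D = (\<lambda>\<omega>. 1 / real n * (\<Sum>i=1..n. ?w (D i \<omega>) * ?Y (D i \<omega>)))"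
    by (simp add: ATE_MR_def fun_eq_iff split_beta')
  \<comment> \<open>The factor \<open>(1 / n)^2\<close> is nonzero and can be removed.\<close>
  have "integrable M (\<lambda>\<omega>. (\<Sum>i=1..n. ?\<rho> (D i \<omega>) * ?Y (D i \<omega>))\<^sup>2)"
    using finite_var n_pos unfolding IPW power_mult_distrib by simp
  \<comment> \<open>One index is enough, since every observation has law \<open>P\<close>; index 1
    is in range because \<open>1 \<le> n\<close>.\<close>
  with M.indep_vars_compose2[OF indep f]
  have "integrable M (\<lambda>\<omega>. (?\<rho> (D 1 \<omega>) * ?Y (D 1 \<omega>))\<^sup>2)"
    by (rule M.integrable_square_indep_vars[OF finite_atLeastAtMost _ one_in])
  then have sq: "integrable P (\<lambda>z. (?\<rho> z * ?Y z)\<^sup>2)"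
    unfolding distr[OF one_in, symmetric]
    by (subst integrable_distr_eq[OF D[OF one_in] borel_measurable_power[OF f]])
  note cv = P.cond_variance_weighted[OF Y \<rho> sq w cond]
  have "M.variance (ATE_IPW \<pi>b n D)
      = 1 / real n * ((LINT z|P. (?\<rho> z * ?Y z)\<^sup>2) - (LINT z|P. ?\<rho> z * ?Y z)\<^sup>2)"
    unfolding IPW by (rule M.variance_sample_mean[OF n_pos indep distr f sq])
  \<comment> \<open>The second moment required here is \<open>cv(1)\<close>, obtained from
    \<open>sq\<close> by conditional Jensen.\<close>
  moreover have "M.variance (ATE_MR mX pX pY \<pi>b n D)
      = 1 / real n * ((LINT z|P. (?w z * ?Y z)\<^sup>2) - (LINT z|P. ?w z * ?Y z)\<^sup>2)"
    unfolding MR by (rule M.variance_sample_mean[OF n_pos indep distr g cv(1)])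
  ultimately have diff: "M.variance (ATE_IPW \<pi>b n D) - M.variance (ATE_MR mX pX pY \<pi>b n D)
      = 1 / real n * (LINT z|P. cond_variance P ?Y ?\<rho> z * (?Y z)\<^sup>2)"
    by (simp only: cv(2,3) right_diff_distrib[symmetric]) simp
  have nonneg: "0 \<le> 1 / real n * (LINT z|P. cond_variance P ?Y ?\<rho> z * (?Y z)\<^sup>2)"
    using cv(4) by simp
  have "(LINT z|P. cond_variance P ?Y ?\<rho> z * (?Y z)\<^sup>2)
      = (LINT (x, a, y)|P. cond_variance P ?Y ?\<rho> (x, a, y) * y\<^sup>2)"
    by (rule arg_cong[where f = "integral\<^sup>L P"]) auto
  note * = diff[unfolded this] nonneg[unfolded this]
  with diff nonneg have "M.variance (ATE_MR mX pX pY \<pi>b n D) \<le> M.variance (ATE_IPW \<pi>b n D)"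
    by linarith
  with * show ?thesis
    by blast
qed

end
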